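(* Let $N,k,e\in\mathbb{N}$ and let $r$ be an odd prime with $\gcd(Nk,r)=1$. Then \[ |\mathcal{L}_{N,r^{e+1},k}|= \begin{cases} |\mathcal{L}_{N,r^e,k}|\cdot r & \text{if } (k^{-1}N\,|\,r)=-1,\\ |\mathcal{L}_{N,r^e,k}|\cdot r-2^{\,e \bmod 2}\cdot (r-1) & \text{if } (k^{-1}N\,|\,r)=1, \end{cases} \] i.e. in the second case one subtracts $2(r-1)$ when $e$ is odd and $r-1$ when $e$ is even.
   Context: For $N,m,k\in\mathbb{N}$ with $\gcd(Nk,m)=1$, $\mathcal{H}_{N,m}:=\{(x,y)\in(\mathbb{Z}/m\mathbb{Z})^2: xy\equiv N \bmod m\}$ and $\mathcal{L}_{N,m,k}:=\{kx+y\bmod m:(x,y)\in\mathcal{H}_{N,m}\}$. Here $k^{-1}$ denotes the inverse of $k$ modulo $r$ and $(\cdot|\cdot)$ is the Legendre symbol. *)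

theory Defs
  imports "HOL-Number_Theory.Number_Theory"
begin

text \<open>Elements of \<open>\<int>/m\<int>\<close> are represented by their least non-negative residues \<open>0, ..., m - 1\<close>.\<close>

definition modular_hyperbola :: "nat \<Rightarrow> nat \<Rightarrow> (nat \<times> nat) set" where
  "modular_hyperbola N m = {(x, y). x \<in> {0..<m} \<and> y \<in> {0..<m} \<and> [x * y = N] (mod m)}"

definition hyperbola_values :: "nat \<Rightarrow> nat \<Rightarrow> nat \<Rightarrow> nat set" where
  "hyperbola_values N m k = {(k * x + y) mod m | x y. (x, y) \<in> modular_hyperbola N m}"

end

(*
  Multiplying k x^2 - t x + N = 0 by 4 k shows that t is a value of k x + y on the hyperbola
  modulo r^e iff the discriminant t^2 - 4 k N is a square modulo r^e. We count the lifts
  t + r^e i, i < r, of each such t that are values modulo r^(e+1). If r^e does not divide the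
  discriminant, all r lifts are, by a Hensel argument. If it does, the discriminant of the lift
  is r^e (w + 2 t i) modulo r^(e+1), where w + 2 t i runs through all residues modulo r; this
  is a square iff w + 2 t i is a square modulo r (e even) or divisible by r (e odd), so
  (r + 1) / 2 or 1 lifts remain. There are 2 or 0 such exceptional t, according to whether
  4 k N is a square modulo r.
*)

theory Submission
  imports Defs
begin

section \<open>Squares modulo prime powers\<close>

lemma QuadRes_cong:
  assumes "[a = b] (mod m)"
  shows "QuadRes m a \<longleftrightarrow> QuadRes m b"
  using assms unfolding QuadRes_def by (meson cong_sym cong_trans)

text \<open>Square roots are scaled by \<open>a\<close> in one direction and by an inverse of
  \<open>a\<close> in the other. This later removes the factors 4 and
  \<open>k\<^sup>2\<close>.\<close>

lemma QuadRes_mult_square: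
  assumes "coprime a m"
  shows "QuadRes m (a\<^sup>2 * c) \<longleftrightarrow> QuadRes m c"
proof
  assume "QuadRes m c"
  then obtain y where "[y\<^sup>2 = c] (mod m)"
    unfolding QuadRes_def by blast
  then have "[(a * y)\<^sup>2 = a\<^sup>2 * c] (mod m)"
    by (simp add: power_mult_distrib cong_mult)
  then show "QuadRes m (a\<^sup>2 * c)"
    unfolding QuadRes_def by blast
next
  assume "QuadRes m (a\<^sup>2 * c)"
  then obtain y where y: "[y\<^sup>2 = a\<^sup>2 * c] (mod m)"
    unfolding QuadRes_def by blast
  obtain b where b: "[a * b = 1] (mod m)"
    using cong_solve_coprime_int[OF assms] by blast
  have "[(b * y)\<^sup>2 = b\<^sup>2 * (a\<^sup>2 * c)] (mod m)"
    using y by (simp add: power_mult_distrib cong_mult)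
  also have "b\<^sup>2 * (a\<^sup>2 * c) = (a * b)\<^sup>2 * c"
    by (simp add: power_mult_distrib)
  also have "[(a * b)\<^sup>2 * c = 1\<^sup>2 * c] (mod m)"
    by (intro cong_mult cong_pow b cong_refl)
  finally show "QuadRes m c"
    unfolding QuadRes_def by auto
qed

text \<open>Any root \<open>s\<close> satisfies \<open>p ^ e dvd s\<^sup>2\<close>, so
  \<open>s = p ^ f * u\<close> with \<open>f = e div 2\<close>. For even \<open>e\<close>,
  cancelling \<open>p ^ e\<close> leaves \<open>u\<^sup>2 = w\<close> modulo \<open>p\<close>. For
  odd \<open>e\<close>, a further factor \<open>p\<close> must divide \<open>u\<close>, so
  \<open>s\<^sup>2\<close> vanishes modulo \<open>p ^ Suc e\<close> and \<open>p\<close> divides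
  \<open>w\<close>.\<close>

lemma QuadRes_prime_power_dvd_iff:
  fixes p w :: int
  assumes "prime p"
  shows "QuadRes (p ^ Suc e) (p ^ e * w) \<longleftrightarrow> (if even e then QuadRes p w else p dvd w)"
proof -
  have p0: "p \<noteq> 0"
    using assms by auto
  show ?thesis
  proof (cases "even e")
    case True
    then obtain f where e: "e = 2 * f"
      by blast
    have pe: "p ^ e = (p ^ f)\<^sup>2"
      by (simp add: e power_mult[symmetric] mult.commute)
    have "QuadRes (p ^ Suc e) (p ^ e * w) \<longleftrightarrow> QuadRes p w"
    proof
      assume "QuadRes (p ^ Suc e) (p ^ e * w)"
      then obtain s where s: "p ^ e * p dvd s\<^sup>2 - p ^ e * w"
        unfolding QuadRes_def cong_iff_dvd_diff by (auto simp: mult.commute)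
      then have "p ^ e dvd s\<^sup>2 - p ^ e * w"
        by (rule dvd_mult_left)
      then have "p ^ e dvd s\<^sup>2"
        by (simp add: dvd_diff_left_iff)
      then have "p ^ f dvd s"
        by (simp add: pe)
      then obtain u where u: "s = p ^ f * u"
        by blast
      have "s\<^sup>2 - p ^ e * w = p ^ e * (u\<^sup>2 - w)"
        by (simp add: u pe power_mult_distrib algebra_simps)
      with s p0 have "p dvd u\<^sup>2 - w"
        by simp
      then show "QuadRes p w"
        unfolding QuadRes_def cong_iff_dvd_diff by blast
    next
      assume "QuadRes p w"
      then obtain u where u: "p dvd u\<^sup>2 - w"
        unfolding QuadRes_def cong_iff_dvd_diff by blast
      have "(p ^ f * u)\<^sup>2 - p ^ e * w = p ^ e * (u\<^sup>2 - w)"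
        by (simp add: pe power_mult_distrib algebra_simps)
      with u have "p ^ Suc e dvd (p ^ f * u)\<^sup>2 - p ^ e * w"
        by (simp add: mult.commute mult_dvd_mono)
      then show "QuadRes (p ^ Suc e) (p ^ e * w)"
        unfolding QuadRes_def cong_iff_dvd_diff by blast
    qed
    then show ?thesis
      using True by simp
  next
    case False
    then obtain f where e: "e = 2 * f + 1"
      using oddE by blast
    have pe: "p ^ e = (p ^ f)\<^sup>2 * p"
      by (simp add: e power_mult[symmetric] mult.commute)
    have "QuadRes (p ^ Suc e) (p ^ e * w) \<longleftrightarrow> p dvd w"
    proof
      assume "QuadRes (p ^ Suc e) (p ^ e * w)"
      then obtain s where s: "p ^ e * p dvd s\<^sup>2 - p ^ e * w"
        unfolding QuadRes_def cong_iff_dvd_diff by (auto simp: mult.commute)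
      then have "p ^ e dvd s\<^sup>2 - p ^ e * w"
        by (rule dvd_mult_left)
      then have *: "p ^ e dvd s\<^sup>2"
        by (simp add: dvd_diff_left_iff)
      then have "p ^ f dvd s"
        unfolding pe by (metis dvd_mult_left pow_divides_pow_iff zero_less_numeral)
      then obtain u where u: "s = p ^ f * u"
        by blast
      have "p dvd u\<^sup>2"
        using * p0 by (simp add: u pe power_mult_distrib)
      then have "p dvd u"
        using assms prime_dvd_power by blast
      then obtain v where v: "u = p * v"
        by blast
      have "s\<^sup>2 - p ^ e * w = p ^ e * (p * v\<^sup>2 - w)"
        by (simp add: u v pe power_mult_distrib power2_eq_square[of p] algebra_simps)
      with s p0 have "p dvd p * v\<^sup>2 - w"
        by simp
      then show "p dvd w"
        by (metis dvd_diff_right_iff dvd_triv_left)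
    next
      assume "p dvd w"
      \<comment> \<open>Now \<open>p ^ e * w\<close> vanishes modulo \<open>p ^ Suc e\<close>, so 0
        is a root.\<close>
      then have "p ^ Suc e dvd 0\<^sup>2 - p ^ e * w"
        by (simp add: mult.commute mult_dvd_mono)
      then show "QuadRes (p ^ Suc e) (p ^ e * w)"
        unfolding QuadRes_def cong_iff_dvd_diff by blast
    qed
    then show ?thesis
      using False by simp
  qed
qed

text \<open>Hensel lifting for a root \<open>s\<close> that may be divisible by \<open>p\<close>. As
  \<open>p ^ e\<close> does not divide \<open>D\<close>, it does not divide
  \<open>s\<^sup>2\<close>, so the multiplicity \<open>i\<close> of \<open>p\<close> in
  \<open>s\<close> satisfies \<open>2 * i < e\<close>. This leaves room to correct \<open>s\<close>
  by a multiple of \<open>p ^ (e - i)\<close>.\<close>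

lemma QuadRes_prime_power_Suc:
  fixes p D :: int
  assumes "prime p" and "\<not> p dvd 2" and "QuadRes (p ^ e) D" and "\<not> p ^ e dvd D"
  shows "QuadRes (p ^ Suc e) D"
proof -
  obtain s where "p ^ e dvd s\<^sup>2 - D"
    using assms(3) unfolding QuadRes_def cong_iff_dvd_diff by blast
  then obtain q where q: "s\<^sup>2 = D + p ^ e * q"
    by (metis dvdE diff_add_cancel add.commute)
  have nd: "\<not> p ^ e dvd s\<^sup>2"
    using assms(4) q by (simp add: dvd_add_left_iff)
  then have "s \<noteq> 0"
    by auto
  moreover have "\<not> is_unit p"
    using assms(1) not_prime_unit by blast
  ultimately obtain u where su: "s = p ^ multiplicity p s * u" and u: "\<not> p dvd u"
    using multiplicity_decompose'[of s p] by metis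
  define i where "i = multiplicity p s"
  have s: "s = p ^ i * u"
    using su by (simp add: i_def)
  have "2 * i < e"
  proof (rule ccontr)
    assume "\<not> 2 * i < e"
    then have "p ^ e dvd p ^ (2 * i)"
      by (simp add: le_imp_power_dvd)
    then have "p ^ e dvd s\<^sup>2"
      by (simp add: s power_mult_distrib power_mult[symmetric] mult.commute)
    with nd show False ..
  qed
  \<comment> \<open>In this form \<open>e - i\<close> is \<open>i + Suc d\<close>, and twice that
    exponent is \<open>Suc e + d\<close>.\<close>
  then obtain d where d: "e = 2 * i + Suc d"
    using less_iff_Suc_add by auto
  have "coprime (2 * u) p"
    using assms(1,2) u by (metis prime_imp_coprime coprime_commute prime_dvd_mult_iff)
  then obtain h0 where h0: "[2 * u * h0 = 1] (mod p)"
    using cong_solve_coprime_int by blast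
  \<comment> \<open>The root \<open>s\<close> is perturbed in degree \<open>e - i\<close>, where the cross term is \<open>2 u h p\<^sup>e\<close> and the square vanishes modulo \<open>p\<^bsup>e+1\<^esup>\<close>.\<close>
  define h where "h = - q * h0"
  \<comment> \<open>The value of \<open>h\<close> is the one that cancels \<open>q\<close>, the
    coefficient of \<open>p ^ e\<close> in \<open>s\<^sup>2 - D\<close>, modulo
    \<open>p\<close>.\<close>
  have "[2 * u * h0 * (- q) = 1 * (- q)] (mod p)"
    by (intro cong_mult h0 cong_refl)
  then have "p dvd q + 2 * u * h"
    unfolding cong_iff_dvd_diff h_def by (simp add: algebra_simps)
  then obtain g where g: "q + 2 * u * h = p * g"
    by blast
  have pe: "p ^ e = p ^ i * p ^ i * (p * p ^ d)" and pid: "p ^ (i + Suc d) = p ^ i * (p * p ^ d)"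
    by (simp_all add: d mult_2 power_add)
  have "(s + p ^ (i + Suc d) * h)\<^sup>2 - D
      = (s\<^sup>2 - D) + 2 * u * h * p ^ e + p ^ Suc e * (p ^ d * h\<^sup>2)"
    unfolding pe pid power_Suc by (simp add: s power2_eq_square algebra_simps)
  also have "\<dots> = p ^ e * (q + 2 * u * h) + p ^ Suc e * (p ^ d * h\<^sup>2)"
    by (simp add: q algebra_simps)
  also have "\<dots> = p ^ Suc e * (g + p ^ d * h\<^sup>2)"
    unfolding g by (simp add: algebra_simps)
  finally have "p ^ Suc e dvd (s + p ^ (i + Suc d) * h)\<^sup>2 - D"
    by simp
  then show ?thesis
    unfolding QuadRes_def cong_iff_dvd_diff by blast
qed

text \<open>Iterated lifting from exponent 1. No \<open>p ^ n\<close> with \<open>n \<ge> 1\<close>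
  divides \<open>c\<close>, since \<open>p\<close> does not, so each lifting step applies.\<close>

lemma QuadRes_prime_power:
  fixes p c :: int
  assumes "prime p" and "\<not> p dvd 2" and "QuadRes p c" and "\<not> p dvd c" and "e \<ge> 1"
  shows "QuadRes (p ^ e) c"
  using assms(5)
proof (induction e rule: dec_induct)
  case base
  then show ?case
    using assms(3) by simp
next
  case (step n)
  have "\<not> p ^ n dvd c"
    using step(1) assms(4) by (metis dvd_power dvd_trans less_le_trans zero_less_one)
  then show ?case
    using QuadRes_prime_power_Suc assms step.IH by blast
qed

section \<open>Counting residues modulo a prime\<close>

text \<open>The numbers \<open>0, ..., r div 2\<close> represent all residues up to sign, and their
  squares are distinct modulo \<open>r\<close>. The residue 0 counts as a square.\<close>

lemma card_QuadRes_prime: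
  fixes r :: nat
  assumes "prime r" and "odd r"
  shows "card {w \<in> {0..<r}. QuadRes (int r) (int w)} = r div 2 + 1"
proof -
  have r: "r > 0"
    using assms(1) prime_gt_0_nat by blast
  have "{w \<in> {0..<r}. QuadRes (int r) (int w)} = (\<lambda>x. x\<^sup>2 mod r) ` {0..r div 2}"
  proof (intro equalityI subsetI)
    fix w
    assume "w \<in> {w \<in> {0..<r}. QuadRes (int r) (int w)}"
    then obtain y where w: "w < r" and y: "[y\<^sup>2 = int w] (mod int r)"
      unfolding QuadRes_def by auto
    define x where "x = nat (y mod int r)"
    have x: "int x = y mod int r" "x < r"
      using r by (auto simp: x_def nat_less_iff)
    have "[(int x)\<^sup>2 = int w] (mod int r)"
      using y by (simp add: x cong_def power_mod)
    then have xw: "[x\<^sup>2 = w] (mod r)"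
      by (metis cong_int_iff of_nat_power)
    show "w \<in> (\<lambda>x. x\<^sup>2 mod r) ` {0..r div 2}"
    proof (cases "x \<le> r div 2")
      case True
      then show ?thesis
        using xw w by (intro image_eqI[of _ _ x]) (auto simp: cong_def)
    next
      case False
      \<comment> \<open>The reflected root \<open>r - x\<close> has the same square and is at most
        \<open>r div 2\<close>.\<close>
      have "int (r - x) = int r - int x"
        using x by simp
      then have "[(int (r - x))\<^sup>2 = (int x)\<^sup>2] (mod int r)"
        by (simp add: cong_iff_dvd_diff power2_eq_square algebra_simps)
      then have "[(r - x)\<^sup>2 = x\<^sup>2] (mod r)"
        by (metis cong_int_iff of_nat_power)
      with xw have "[(r - x)\<^sup>2 = w] (mod r)"
        using cong_trans by blast
      then show ?thesis
        using w False by (intro image_eqI[of _ _ "r - x"]) (auto simp: cong_def)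
    qed
  next
    fix w
    assume "w \<in> (\<lambda>x. x\<^sup>2 mod r) ` {0..r div 2}"
    then obtain x where "w = x\<^sup>2 mod r"
      by blast
    then show "w \<in> {w \<in> {0..<r}. QuadRes (int r) (int w)}"
      using r unfolding QuadRes_def
      by (auto intro!: exI[of _ "int x"] simp: cong_def zmod_int)
  qed
  moreover have "inj_on (\<lambda>x. x\<^sup>2 mod r) {0..r div 2}"
  proof (rule inj_onI)
    fix x y
    assume xy: "x \<in> {0..r div 2}" "y \<in> {0..r div 2}" and "x\<^sup>2 mod r = y\<^sup>2 mod r"
    then have "[(int x)\<^sup>2 = (int y)\<^sup>2] (mod int r)"
      by (metis cong_def cong_int_iff of_nat_power)
    then have "int r dvd (int x - int y) * (int x + int y)"
      by (simp add: cong_iff_dvd_diff power2_eq_square algebra_simps)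
    then have "int r dvd int x - int y \<or> int r dvd int x + int y"
      using assms(1) by (simp add: prime_dvd_mult_iff)
    \<comment> \<open>As \<open>r\<close> is odd, \<open>x + y \<le> 2 * (r div 2) = r - 1\<close>.
      Hence whichever factor \<open>r\<close> divides is zero; a zero sum forces
      \<open>x = y = 0\<close>.\<close>
    moreover have "\<bar>int x - int y\<bar> < int r" "x + y < r"
      using xy assms(2) r by (auto elim!: oddE)
    ultimately show "x = y"
      by (metis add_eq_0_iff_both_eq_0 dvd_imp_le_int eq_iff_diff_eq_0 gr0I int_dvd_int_iff
          int_int_eq linorder_not_le nat_dvd_not_less of_nat_add abs_of_nat)
  qed
  ultimately show ?thesis
    by (simp add: card_image)
qed

text \<open>Since \<open>\<beta>\<close> is a unit, the affine map permutes the residues modulo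
  \<open>r\<close>.\<close>

lemma card_affine_periodic:
  fixes r :: nat and \<alpha> \<beta> :: int
  assumes "coprime \<beta> (int r)" and "r > 0"
    and per: "\<And>a b. [a = b] (mod int r) \<Longrightarrow> P a \<longleftrightarrow> P b"
  shows "card {i \<in> {0..<r}. P (\<alpha> + \<beta> * int i)} = card {w \<in> {0..<r}. P (int w)}"
proof -
  define f where "f i = nat ((\<alpha> + \<beta> * int i) mod int r)" for i :: nat
  have f: "int (f i) = (\<alpha> + \<beta> * int i) mod int r" for i
    using assms(2) by (simp add: f_def)
  have Pf: "P (int (f i)) \<longleftrightarrow> P (\<alpha> + \<beta> * int i)" for i
    by (intro per) (simp add: f)
  have inj: "inj_on f {0..<r}"
  proof (rule inj_onI)
    fix i j
    assume ij: "i \<in> {0..<r}" "j \<in> {0..<r}" and "f i = f j"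
    then have "[\<alpha> + \<beta> * int i = \<alpha> + \<beta> * int j] (mod int r)"
      by (metis f cong_def)
    then have "[int i = int j] (mod int r)"
      using assms(1) by (simp add: cong_add_lcancel cong_mult_lcancel)
    then show "i = j"
      using ij by (simp add: cong_int_iff cong_def)
  qed
  have "f ` {0..<r} = {0..<r}"
  proof (rule endo_inj_surj)
    show "f ` {0..<r} \<subseteq> {0..<r}"
      using assms(2) by (auto simp: f_def nat_less_iff)
  qed (use inj in auto)
  then have "{w \<in> {0..<r}. P (int w)} = f ` {i \<in> {0..<r}. P (\<alpha> + \<beta> * int i)}"
    by (auto simp: Pf) (metis (mono_tags, lifting) Pf imageE imageI mem_Collect_eq
        atLeastLessThan_iff le0)
  moreover have "inj_on f {i \<in> {0..<r}. P (\<alpha> + \<beta> * int i)}"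
    using inj by (rule inj_on_subset) auto
  ultimately show ?thesis
    by (simp add: card_image)
qed

section \<open>Hyperbola values and discriminants\<close>

text \<open>For \<open>t = k * x + y\<close> and \<open>x * y = N\<close> the discriminant is the
  square of \<open>k * x - y\<close>. Conversely, a root of the discriminant yields \<open>x\<close>
  by the quadratic formula, as \<open>2 * k\<close> is invertible modulo \<open>m\<close>.\<close>

lemma hyperbola_values_eq:
  assumes "odd m" and "coprime k m"
  shows "hyperbola_values N m k =
    {t \<in> {0..<m}. QuadRes (int m) ((int t)\<^sup>2 - 4 * int k * int N)}"
proof (intro equalityI subsetI)
  have m: "m > 0"
    using assms(1) by (auto intro: gr0I)
  fix t
  assume "t \<in> hyperbola_values N m k"
  then obtain x y where t: "t = (k * x + y) mod m" and "[x * y = N] (mod m)"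
    unfolding hyperbola_values_def modular_hyperbola_def by auto
  then have xy: "[int x * int y = int N] (mod int m)"
    by (metis cong_int_iff of_nat_mult)
  have "[int t = int k * int x + int y] (mod int m)"
    by (simp add: t zmod_int)
  then have "[(int t)\<^sup>2 - 4 * int k * int N
      = (int k * int x + int y)\<^sup>2 - 4 * int k * (int x * int y)] (mod int m)"
    using xy by (intro cong_diff cong_pow cong_mult cong_refl) (auto simp: cong_sym)
  also have "(int k * int x + int y)\<^sup>2 - 4 * int k * (int x * int y) = (int k * int x - int y)\<^sup>2"
    by (simp add: power2_eq_square algebra_simps)
  finally have "QuadRes (int m) ((int t)\<^sup>2 - 4 * int k * int N)"
    unfolding QuadRes_def using cong_sym by blast
  then show "t \<in> {t \<in> {0..<m}. QuadRes (int m) ((int t)\<^sup>2 - 4 * int k * int N)}"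
    using m by (simp add: t)
next
  have m: "m > 0"
    using assms(1) by (auto intro: gr0I)
  fix t
  assume "t \<in> {t \<in> {0..<m}. QuadRes (int m) ((int t)\<^sup>2 - 4 * int k * int N)}"
  then obtain s where t: "t < m" and s: "[s\<^sup>2 = (int t)\<^sup>2 - 4 * int k * int N] (mod int m)"
    unfolding QuadRes_def by auto
  have c2: "coprime (2 * int k) (int m)"
    using assms by (simp add: coprime_mult_left_iff)
  then obtain z where z: "[2 * int k * z = 1] (mod int m)"
    using cong_solve_coprime_int by blast
  \<comment> \<open>Adding \<open>t = k * x + y\<close> and \<open>s = k * x - y\<close> gives
    \<open>2 * k * x = t + s\<close>, and \<open>z\<close> inverts \<open>2 * k\<close>.\<close>
  define X where "X = z * (int t + s)"
  define Y where "Y = int t - int k * X"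
  have X: "[2 * int k * X = int t + s] (mod int m)"
    using cong_mult[OF z cong_refl[of "int t + s"]] by (simp add: X_def mult.assoc)
  have "4 * int k * (X * Y) = 2 * int k * X * (2 * int t - 2 * int k * X)"
    by (simp add: Y_def algebra_simps)
  also have "[\<dots> = (int t + s) * (2 * int t - (int t + s))] (mod int m)"
    by (intro cong_mult cong_diff X cong_refl)
  also have "(int t + s) * (2 * int t - (int t + s)) = (int t)\<^sup>2 - s\<^sup>2"
    by (simp add: power2_eq_square algebra_simps)
  also have "[\<dots> = (int t)\<^sup>2 - ((int t)\<^sup>2 - 4 * int k * int N)] (mod int m)"
    by (intro cong_diff s cong_refl)
  finally have "[4 * int k * (X * Y) = 4 * int k * int N] (mod int m)"
    by simp
  moreover have "coprime (4 * int k) (int m)"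
  proof -
    have "coprime (2 * (2 * int k)) (int m)"
      using c2 unfolding coprime_mult_left_iff by blast
    then show ?thesis
      by simp
  qed
  ultimately have XY: "[X * Y = int N] (mod int m)"
    by (simp add: cong_mult_lcancel)
  define x where "x = nat (X mod int m)"
  define y where "y = nat (Y mod int m)"
  have x: "int x = X mod int m" and y: "int y = Y mod int m"
    using m by (simp_all add: x_def y_def)
  have "[int (x * y) = int N] (mod int m)"
    using XY by (simp add: x y cong_def mod_mult_eq)
  then have "[x * y = N] (mod m)"
    by (simp only: cong_int_iff)
  moreover have "x < m" "y < m"
    using m by (simp_all add: x_def y_def nat_less_iff)
  ultimately have "(x, y) \<in> modular_hyperbola N m"
    by (simp add: modular_hyperbola_def)
  moreover have "t = (k * x + y) mod m"
  proof -
    have "[int (k * x + y) = int k * X + Y] (mod int m)"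
      unfolding of_nat_add of_nat_mult x y by (intro cong_add cong_mult cong_refl) simp_all
    then have "[int (k * x + y) = int t] (mod int m)"
      by (simp add: Y_def)
    then have "[k * x + y = t] (mod m)"
      by (simp only: cong_int_iff)
    then show ?thesis
      using t by (simp add: cong_def)
  qed
  ultimately show "t \<in> hyperbola_values N m k"
    unfolding hyperbola_values_def by blast
qed

section \<open>Square roots of a unit modulo a prime power\<close>

lemma odd_prime_not_dvd_2:
  fixes r :: nat
  assumes "prime r" and "odd r"
  shows "\<not> int r dvd 2"
proof
  assume "int r dvd 2"
  then have "r dvd 2"
    by (metis int_dvd_int_iff of_nat_numeral)
  then have "r = 2"
    using assms(1) primes_dvd_imp_eq two_is_prime_nat by blast
  with assms(2) show False
    by simp
qed

text \<open>With one root \<open>a\<close>, any root \<open>s\<close> makes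
  \<open>(s - a) * (s + a)\<close> divisible by \<open>r ^ e\<close>. The factors differ by
  \<open>2 * a\<close>, which is prime to \<open>r\<close>, so one of them absorbs the whole power.
  The roots are therefore \<open>a\<close> and \<open>- a\<close>, which are distinct.\<close>

lemma card_square_roots_prime_power:
  fixes r :: nat and c :: int
  assumes "prime r" and "odd r" and "QuadRes (int r) c" and "\<not> int r dvd c" and "e \<ge> 1"
  shows "card {s \<in> {0..<r ^ e}. int r ^ e dvd (int s)\<^sup>2 - c} = 2"
proof -
  let ?M = "int r ^ e"
  have p: "prime (int r)" and p2: "\<not> int r dvd 2"
    using assms(1,2) odd_prime_not_dvd_2 by simp_all
  have M: "?M > 0"
    using assms(1) prime_gt_0_nat by simp
  have rM: "int r dvd ?M"
    using assms(5) by (simp add: dvd_power)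
  obtain a where a: "?M dvd a\<^sup>2 - c"
    using QuadRes_prime_power[OF p p2 assms(3,4,5)] unfolding QuadRes_def cong_iff_dvd_diff by blast
  have ra: "\<not> int r dvd a"
  proof
    assume "int r dvd a"
    then have "int r dvd a\<^sup>2"
      by (simp add: power2_eq_square)
    with dvd_trans[OF rM a] have "int r dvd c"
      by (simp add: dvd_diff_right_iff)
    with assms(4) show False ..
  qed
  have r2a: "\<not> int r dvd 2 * a"
    using p p2 ra by (simp add: prime_dvd_mult_iff)
  have root_iff: "?M dvd (int s)\<^sup>2 - c \<longleftrightarrow> ?M dvd int s - a \<or> ?M dvd int s + a" for s
  proof -
    have "?M dvd (int s)\<^sup>2 - c \<longleftrightarrow> ?M dvd ((int s)\<^sup>2 - a\<^sup>2) + (a\<^sup>2 - c)"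
      by simp
    also have "\<dots> \<longleftrightarrow> ?M dvd (int s)\<^sup>2 - a\<^sup>2"
      using a by (rule dvd_add_left_iff)
    also have "(int s)\<^sup>2 - a\<^sup>2 = (int s - a) * (int s + a)"
      by (simp add: power2_eq_square algebra_simps)
    also have "?M dvd (int s - a) * (int s + a) \<longleftrightarrow> ?M dvd int s - a \<or> ?M dvd int s + a"
    proof
      assume *: "?M dvd (int s - a) * (int s + a)"
      have "\<not> int r dvd int s - a \<or> \<not> int r dvd int s + a"
      proof (rule ccontr)
        assume "\<not> ?thesis"
        then have "int r dvd (int s + a) - (int s - a)"
          using dvd_diff by blast
        with r2a show False
          by simp
      qed
      then have "coprime ?M (int s - a) \<or> coprime ?M (int s + a)"
        using p prime_imp_coprime coprime_power_left_iff by blast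
      then show "?M dvd int s - a \<or> ?M dvd int s + a"
        using * by (metis coprime_dvd_mult_left_iff coprime_dvd_mult_right_iff)
    qed auto
    finally show ?thesis .
  qed
  have res: "?M dvd int s - b \<longleftrightarrow> s = nat (b mod ?M)" if "s < r ^ e" for s b
  proof -
    have "int s < ?M"
      using that by (metis of_nat_less_iff of_nat_power)
    then show ?thesis
      using M by (auto simp: mod_eq_dvd_iff[symmetric])
  qed
  have "{s \<in> {0..<r ^ e}. ?M dvd (int s)\<^sup>2 - c} = {nat (a mod ?M), nat (- a mod ?M)}"
  proof -
    have "nat (b mod ?M) < r ^ e" for b
      using M by (simp add: nat_less_iff)
    then show ?thesis
      using res[of _ a] res[of _ "- a"] by (auto simp: root_iff)
  qed
  moreover have "nat (a mod ?M) \<noteq> nat (- a mod ?M)"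
  proof
    assume "nat (a mod ?M) = nat (- a mod ?M)"
    then have "a mod ?M = - a mod ?M"
      using M by (simp add: nat_eq_iff)
    then have "?M dvd a - (- a)"
      by (simp only: mod_eq_dvd_iff)
    with rM have "int r dvd 2 * a"
      using dvd_trans by fastforce
    with r2a show False ..
  qed
  ultimately show ?thesis
    by simp
qed

section \<open>Counting the lifts of residues\<close>

text \<open>Division with remainder by \<open>M\<close> groups the residues modulo
  \<open>M * r\<close> by their reduction modulo \<open>M\<close>.\<close>

lemma card_lifted_residues:
  fixes r M :: nat
  shows "card {t \<in> {0..<M * r}. P t} = (\<Sum>s\<in>{0..<M}. card {i \<in> {0..<r}. P (s + M * i)})"
proof (cases "M = 0")
  case False
  let ?A = "Sigma {0..<M} (\<lambda>s. {i \<in> {0..<r}. P (s + M * i)})"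
  have "bij_betw (\<lambda>(s, i). s + M * i) ?A {t \<in> {0..<M * r}. P t}"
  proof (rule bij_betwI[where g = "\<lambda>t. (t mod M, t div M)"])
    show "(\<lambda>(s, i). s + M * i) \<in> ?A \<rightarrow> {t \<in> {0..<M * r}. P t}"
    proof
      fix z
      assume "z \<in> ?A"
      then obtain s i where z: "z = (s, i)" "s < M" "i < r" "P (s + M * i)"
        by auto
      then have "s + M * i < M * Suc i"
        by simp
      also have "\<dots> \<le> M * r"
        using z(3) by (intro mult_le_mono) auto
      finally show "(case z of (s, i) \<Rightarrow> s + M * i) \<in> {t \<in> {0..<M * r}. P t}"
        using z by simp
    qed
    show "(\<lambda>t. (t mod M, t div M)) \<in> {t \<in> {0..<M * r}. P t} \<rightarrow> ?A"
      using False by (auto simp: less_mult_imp_div_less mult.commute)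
  qed (use False in auto)
  then have "card {t \<in> {0..<M * r}. P t} = card ?A"
    by (simp add: bij_betw_same_card)
  then show ?thesis
    by simp
qed simp

text \<open>All lifts of \<open>s\<close> have the same discriminant modulo \<open>r ^ e\<close>. If
  it is nonzero there, Hensel lifting and reduction make squareness independent of \<open>i\<close>.
  If it is zero, the criterion for \<open>p ^ e * w\<close> applies along the progression
  \<open>w + 2 * s * i\<close>, whose step is a unit because \<open>r\<close> does not divide
  \<open>c\<close>.\<close>

lemma card_square_discriminant_fiber:
  fixes r s :: nat and c :: int
  assumes "prime r" and "odd r" and "\<not> int r dvd c" and "e \<ge> 1"
  shows "card {i \<in> {0..<r}. QuadRes (int r ^ Suc e) ((int (s + r ^ e * i))\<^sup>2 - c)} =
    (if int r ^ e dvd (int s)\<^sup>2 - c then (if even e then r div 2 + 1 else 1)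
     else if QuadRes (int r ^ e) ((int s)\<^sup>2 - c) then r else 0)"
proof -
  let ?M = "int r ^ e"
  have p: "prime (int r)" and p2: "\<not> int r dvd 2"
    using assms(1,2) odd_prime_not_dvd_2 by simp_all
  have r: "r > 0"
    using assms(1) prime_gt_0_nat by blast
  have rM: "int r dvd ?M"
    using assms(4) by (simp add: dvd_power)
  have step: "[(int (s + r ^ e * i))\<^sup>2 - c = (int s)\<^sup>2 - c] (mod ?M)" for i
    unfolding cong_iff_dvd_diff by (simp add: power2_eq_square algebra_simps)
  have down: "QuadRes ?M D" if "QuadRes (int r ^ Suc e) D" for D
    using that unfolding QuadRes_def cong_iff_dvd_diff by (auto dest: dvd_mult_right)
  show ?thesis
  proof (cases "?M dvd (int s)\<^sup>2 - c")
    case True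
    then obtain w where w: "(int s)\<^sup>2 - c = ?M * w"
      by blast
    define P where "P x = (if even e then QuadRes (int r) x else int r dvd x)" for x
    have per: "P x \<longleftrightarrow> P y" if "[x = y] (mod int r)" for x y
      using QuadRes_cong[OF that] cong_dvd_iff[OF that] by (simp add: P_def)
    have "\<not> int r dvd int s"
    proof
      assume "int r dvd int s"
      then have "int r dvd (int s)\<^sup>2"
        by (simp add: power2_eq_square)
      with dvd_trans[OF rM True] have "int r dvd c"
        by (simp add: dvd_diff_right_iff)
      with assms(3) show False ..
    qed
    then have "coprime (2 * int s) (int r)"
      using p p2 by (metis prime_imp_coprime coprime_commute prime_dvd_mult_iff)
    moreover have "QuadRes (int r ^ Suc e) ((int (s + r ^ e * i))\<^sup>2 - c)
        \<longleftrightarrow> P (w + 2 * int s * int i)" for i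
    proof -
      have "(int (s + r ^ e * i))\<^sup>2 - c = ((int s)\<^sup>2 - c) + ?M * (2 * int s * int i + ?M * (int i)\<^sup>2)"
        by (simp add: power2_eq_square algebra_simps)
      also have "\<dots> = ?M * (w + 2 * int s * int i + ?M * (int i)\<^sup>2)"
        by (simp add: w algebra_simps)
      finally have "QuadRes (int r ^ Suc e) ((int (s + r ^ e * i))\<^sup>2 - c)
          \<longleftrightarrow> P (w + 2 * int s * int i + ?M * (int i)\<^sup>2)"
        using QuadRes_prime_power_dvd_iff[OF p] by (simp only: P_def)
      \<comment> \<open>The quadratic term disappears modulo \<open>r\<close> because
        \<open>e \<ge> 1\<close>.\<close>
      also have "\<dots> \<longleftrightarrow> P (w + 2 * int s * int i)"
        using rM by (intro per) (simp add: cong_iff_dvd_diff)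
      finally show ?thesis .
    qed
    ultimately have "card {i \<in> {0..<r}. QuadRes (int r ^ Suc e) ((int (s + r ^ e * i))\<^sup>2 - c)} =
        card {x \<in> {0..<r}. P (int x)}"
      using card_affine_periodic[of "2 * int s" r P w] r per by simp
    also have "\<dots> = (if even e then r div 2 + 1 else 1)"
    proof (cases "even e")
      case True
      then show ?thesis
        using card_QuadRes_prime[OF assms(1,2)] by (simp add: P_def)
    next
      case False
      then have "{x \<in> {0..<r}. P (int x)} = {0}"
        using r by (auto simp: P_def dest: nat_dvd_not_less)
      with False show ?thesis
        by simp
    qed
    finally show ?thesis
      using True by simp
  next
    case False
    have "QuadRes (int r ^ Suc e) ((int (s + r ^ e * i))\<^sup>2 - c) \<longleftrightarrow> QuadRes ?M ((int s)\<^sup>2 - c)" for i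
    proof -
      have "\<not> ?M dvd (int (s + r ^ e * i))\<^sup>2 - c"
        using False step[of i] by (metis cong_0_iff cong_sym cong_trans)
      then show ?thesis
        using QuadRes_prime_power_Suc[OF p p2] down QuadRes_cong[OF step[of i]] by blast
    qed
    then show ?thesis
      using False by simp
  qed
qed

text \<open>Summation of the fibre sizes: each element of \<open>S e\<close> contributes
  \<open>r\<close> lifts, except that those in \<open>R e\<close> contribute fewer. The correction
  term is the total shortfall.\<close>

lemma card_square_discriminants_Suc:
  fixes r :: nat and c :: int
  defines "S \<equiv> \<lambda>e. {t \<in> {0..<r ^ e}. QuadRes (int r ^ e) ((int t)\<^sup>2 - c)}"
    and "R \<equiv> \<lambda>e. {s \<in> {0..<r ^ e}. int r ^ e dvd (int s)\<^sup>2 - c}"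
  assumes "prime r" and "odd r" and "\<not> int r dvd c" and "e \<ge> 1"
  shows "int (card (S (Suc e))) = int (card (S e)) * int r
    - int (card (R e)) * (int r - (if even e then int (r div 2) + 1 else 1))"
proof -
  let ?b = "if even e then r div 2 + 1 else 1"
  have RS: "R e \<subseteq> S e"
  proof -
    have "QuadRes (int r ^ e) D" if "int r ^ e dvd D" for D
      using that unfolding QuadRes_def cong_iff_dvd_diff by (intro exI[of _ 0]) simp
    then show ?thesis
      by (auto simp: R_def S_def)
  qed
  have fin: "finite (S e)"
    by (simp add: S_def)
  have "card (S (Suc e)) = card {t \<in> {0..<r ^ e * r}. QuadRes (int r ^ Suc e) ((int t)\<^sup>2 - c)}"
    by (simp add: S_def mult.commute)
  also have "\<dots> = (\<Sum>s\<in>{0..<r ^ e}. if s \<in> R e then ?b else if s \<in> S e then r else 0)"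
    unfolding card_lifted_residues
    by (rule sum.cong[OF refl], subst card_square_discriminant_fiber[OF assms(3-6)])
      (simp add: R_def S_def)
  also have "\<dots> = (\<Sum>s\<in>S e. if s \<in> R e then ?b else if s \<in> S e then r else 0)"
    by (rule sum.mono_neutral_right) (use RS in \<open>auto simp: S_def\<close>)
  also have "\<dots> = (\<Sum>s\<in>S e - R e. r) + (\<Sum>s\<in>R e. ?b)"
    by (subst sum.subset_diff[OF RS fin]) (intro arg_cong2[of _ _ _ _ "(+)"] sum.cong; simp)
  also have "\<dots> = (card (S e) - card (R e)) * r + card (R e) * ?b"
    using RS fin by (simp add: card_Diff_subset finite_subset)
  finally have "int (card (S (Suc e)))
      = (int (card (S e)) - int (card (R e))) * int r + int (card (R e)) * int ?b"
    using card_mono[OF fin RS] by (simp add: of_nat_diff)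
  then show ?thesis
    by (simp add: algebra_simps)
qed

section \<open>The Legendre symbol and the recursion\<close>

text \<open>The two arguments differ modulo \<open>p\<close> by the unit square
  \<open>k\<^sup>2\<close>.\<close>

lemma QuadRes_modular_inverse_mult:
  fixes p k N :: int
  assumes "coprime p k"
  shows "QuadRes p (modular_inverse p k * N) \<longleftrightarrow> QuadRes p (k * N)"
proof -
  have "[k\<^sup>2 * (modular_inverse p k * N) = k * N] (mod p)"
    using cong_mult[OF cong_modular_inverse1[of k p] cong_refl[of "k * N"]] assms
    by (simp add: power2_eq_square coprime_commute ac_simps)
  then show ?thesis
    using QuadRes_mult_square[of k p "modular_inverse p k * N"] QuadRes_cong assms
    by (metis coprime_commute)
qed

theorem theorem3p5:
  fixes N k e r :: nat
  assumes "N \<ge> 1" and "k \<ge> 1" and "e \<ge> 1"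
    and "prime r" and "odd r" and "gcd (N * k) r = 1"
  shows "(Legendre (modular_inverse (int r) (int k) * int N) (int r) = -1 \<longrightarrow>
            int (card (hyperbola_values N (r ^ (e + 1)) k)) =
              int (card (hyperbola_values N (r ^ e) k)) * int r) \<and>
         (Legendre (modular_inverse (int r) (int k) * int N) (int r) = 1 \<longrightarrow>
            int (card (hyperbola_values N (r ^ (e + 1)) k)) =
              int (card (hyperbola_values N (r ^ e) k)) * int r - 2 ^ (e mod 2) * (int r - 1))"
proof -
  define c where "c = 4 * int k * int N"
  let ?l = "modular_inverse (int r) (int k) * int N"
  let ?R = "{s \<in> {0..<r ^ e}. int r ^ e dvd (int s)\<^sup>2 - c}"
  have cop: "coprime k r" "coprime N r"
    using assms(6) unfolding coprime_iff_gcd_eq_1[symmetric] coprime_mult_left_iff by blast+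
  have p: "prime (int r)"
    using assms(4) by simp
  have cop2: "coprime (2 :: int) (int r)"
    using assms(5) by simp
  have "coprime (2\<^sup>2 * (int k * int N)) (int r)"
    using cop cop2 by (simp only: coprime_mult_left_iff coprime_power_left_iff coprime_int_iff) simp
  then have "coprime c (int r)"
    by (simp add: c_def mult.assoc)
  then have nd: "\<not> int r dvd c"
    using p by (metis coprime_absorb_right not_prime_unit)
  have card_hv: "card (hyperbola_values N (r ^ n) k) =
      card {t \<in> {0..<r ^ n}. QuadRes (int r ^ n) ((int t)\<^sup>2 - c)}" for n
    using hyperbola_values_eq[of "r ^ n" k N] assms(5) cop(1) by (simp add: c_def)
  have rec: "int (card (hyperbola_values N (r ^ (e + 1)) k)) =
      int (card (hyperbola_values N (r ^ e) k)) * int r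
      - int (card ?R) * (int r - (if even e then int (r div 2) + 1 else 1))"
    using card_square_discriminants_Suc[OF assms(4,5) nd assms(3)] by (simp only: card_hv Suc_eq_plus1)
  \<comment> \<open>Up to unit squares modulo \<open>r\<close>, the inverse of \<open>k\<close>
    times \<open>N\<close>, the product \<open>k * N\<close> and \<open>c = 4 * k * N\<close>
    agree.\<close>
  have Q: "QuadRes (int r) ?l \<longleftrightarrow> QuadRes (int r) c"
    using QuadRes_modular_inverse_mult[of "int r" "int k" "int N"] cop(1)
      QuadRes_mult_square[OF cop2, of "int k * int N"]
    by (simp add: c_def coprime_commute mult.assoc)
  show ?thesis
  proof (intro conjI impI)
    assume "Legendre ?l (int r) = -1"
    then have nQ: "\<not> QuadRes (int r) c"
      using Q by (auto simp: Legendre_def split: if_splits)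
    have "?R = {}"
    \<comment> \<open>An element of the set would be a square root of \<open>c\<close> modulo
      \<open>r\<close>.\<close>
    proof (intro equals0I)
      fix s
      assume "s \<in> ?R"
      then have "int r dvd (int s)\<^sup>2 - c"
        using assms(3) by (auto intro: dvd_trans[of _ "int r ^ e"] dvd_power)
      with nQ show False
        unfolding QuadRes_def cong_iff_dvd_diff by blast
    qed
    then show "int (card (hyperbola_values N (r ^ (e + 1)) k)) =
        int (card (hyperbola_values N (r ^ e) k)) * int r"
      using rec by (simp only: card.empty)
  next
    assume "Legendre ?l (int r) = 1"
    then have "QuadRes (int r) c"
      using Q by (auto simp: Legendre_def split: if_splits)
    then have R2: "card ?R = 2"
      using card_square_roots_prime_power assms nd by blast
    have "int r = 2 * int (r div 2) + 1"
      using assms(5) by (auto elim!: oddE)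
    \<comment> \<open>Each of the two exceptional residues loses \<open>(r - 1) / 2\<close> lifts
      for even \<open>e\<close> and \<open>r - 1\<close> for odd \<open>e\<close>.\<close>
    then have b: "2 * (int r - (if even e then int (r div 2) + 1 else 1)) = 2 ^ (e mod 2) * (int r - 1)"
      by (cases "even e") (auto elim: oddE)
    show "int (card (hyperbola_values N (r ^ (e + 1)) k)) =
        int (card (hyperbola_values N (r ^ e) k)) * int r - 2 ^ (e mod 2) * (int r - 1)"
      using rec R2 b by simp
  qed
qed

end
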